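(* Let $R$ be a finite commutative ring with identity, written as a direct sum of local rings $R = R_1\oplus\cdots\oplus R_n$, where $R_i$ has unique maximal ideal $M_i$, $m_i=|M_i|$ and $q_i=|R_i/M_i|$. Assume $q_i>2$ for each $i$. For an integer $k\ge 2$ and a unit $u=(u_1,\ldots,u_n)\in R^*$, let $\theta_{k,R}(u)$ be the number of $k$-tuples $(x_1,\ldots,x_k)\in (R^{**})^k$ with $x_1x_2\cdots x_k=u$. Then $$\theta_{k,R}(u)=\prod_{i=1}^n m_i^{k-1}(q_i-1)^{-1}\sigma_{k,R_i}(u_i),$$ where $$\sigma_{k,R_i}(u_i)=\begin{cases}(q_i-2)^k+(-1)^k(q_i-2) & \text{if } u_i\in 1+M_i,\\ (q_i-2)^k+(-1)^{k+1} & \text{if } u_i\notin 1+M_i.\end{cases}$$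
   Context: A unit $u$ of a commutative ring $R$ with identity is called exceptional if $1-u$ is also a unit; $R^{**}$ denotes the set of exceptional units and $R^*$ the unit group. Every finite commutative ring with identity is uniquely a direct sum of finite local rings. *)

theory Defs
  imports "HOL-Algebra.Algebra" Complex_Main
begin

locale local_ring = cring +
  assumes unique_maximalideal: "\<exists>!M. maximalideal M R"

definition max_ideal :: "('a, 'b) ring_scheme \<Rightarrow> 'a set"
  where "max_ideal R = (THE M. maximalideal M R)"

lemma (in local_ring) maximalideal_iff_max_ideal: "maximalideal M R \<longleftrightarrow> M = max_ideal R"
  unfolding max_ideal_def using unique_maximalideal by (metis theI')

definition residue_card :: "('a, 'b) ring_scheme \<Rightarrow> nat"
  where "residue_card R = card (carrier (R Quot max_ideal R))"

definition exceptional_units :: "('a, 'b) ring_scheme \<Rightarrow> 'a set"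
  where "exceptional_units R = {u \<in> Units R. \<one>\<^bsub>R\<^esub> \<ominus>\<^bsub>R\<^esub> u \<in> Units R}"

(* k-tuples are extensional functions on {1..k}. *)
definition theta :: "nat \<Rightarrow> ('a, 'b) ring_scheme \<Rightarrow> 'a \<Rightarrow> nat"
  where "theta k R u =
    card {x \<in> {1..k} \<rightarrow>\<^sub>E exceptional_units R. (\<Otimes>\<^bsub>R\<^esub> j \<in> {1..k}. x j) = u}"

definition sigma :: "nat \<Rightarrow> ('a, 'b) ring_scheme \<Rightarrow> 'a \<Rightarrow> real"
  where "sigma k R u =
    (let q = real (residue_card R) in
      if u \<in> \<one>\<^bsub>R\<^esub> <+\<^bsub>R\<^esub> max_ideal R
      then (q - 2) ^ k + (-1) ^ k * (q - 2)
      else (q - 2) ^ k + (-1) ^ (k + 1))"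

end

theory Submission
  imports Defs
begin

text \<open>Fixing the last factor of a tuple gives the recurrence
  \<open>theta (k + 1) R u = (\<Sum>y. theta k R (u / y))\<close> over the exceptional units \<open>y\<close>. Exceptional
  units of a finite product of rings are computed componentwise, so distributivity turns the
  recurrence into multiplicativity of \<open>theta\<close>. In a finite local ring with maximal ideal \<open>M\<close>
  the exceptional units are the elements outside the cosets \<open>M\<close> and \<open>1 + M\<close>, and \<open>u / y\<close> lies in
  \<open>1 + M\<close> iff \<open>y\<close> lies in \<open>u + M\<close>. Hence \<open>theta k\<close> takes only two values, \<open>A\<^sub>k\<close> on \<open>1 + M\<close> and
  \<open>B\<^sub>k\<close> on the other units, with \<open>A\<^sub>k\<^sub>+\<^sub>1 = m (q - 2) B\<^sub>k\<close> and \<open>B\<^sub>k\<^sub>+\<^sub>1 = m (A\<^sub>k + (q - 3) B\<^sub>k)\<close>.\<close>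

section \<open>The recurrence\<close>

context cring
begin

lemma exceptional_units_Units: "x \<in> exceptional_units R \<Longrightarrow> x \<in> Units R"
  by (simp add: exceptional_units_def)

lemma exceptional_units_closed: "x \<in> exceptional_units R \<Longrightarrow> x \<in> carrier R"
  by (simp add: exceptional_units_def Units_closed)

lemma finite_exceptional_units: "finite (carrier R) \<Longrightarrow> finite (exceptional_units R)"
  by (rule finite_subset[of _ "carrier R"]) (auto simp: exceptional_units_closed)

lemma mult_eq_iff_eq_mult_inv:
  assumes "y \<in> Units R" "a \<in> carrier R" "u \<in> carrier R"
  shows "y \<otimes> a = u \<longleftrightarrow> a = u \<otimes> inv y"
proof
  assume "y \<otimes> a = u"
  then have "u \<otimes> inv y = a \<otimes> (y \<otimes> inv y)"
    using assms m_comm[of y a] m_assoc[of a y "inv y"] by (simp add: Units_closed)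
  then show "a = u \<otimes> inv y"
    using assms by simp
next
  assume "a = u \<otimes> inv y"
  then have "y \<otimes> a = u \<otimes> (inv y \<otimes> y)"
    using assms m_comm[of y a] m_assoc[of u "inv y" y] by (simp add: Units_closed)
  then show "y \<otimes> a = u"
    using assms by simp
qed

text \<open>The set \<open>{1..0}\<close> is empty, so there is a single tuple and its product is
  the empty product. The inductions for \<open>theta_eq_prod\<close> and \<open>theta_local\<close>
  both bottom out here.\<close>

lemma theta_0: "theta 0 R u = (if u = \<one> then 1 else 0)"
  by (auto simp: theta_def)

lemma theta_Suc:
  assumes fin: "finite (carrier R)" and u: "u \<in> Units R"
  shows "theta (Suc k) R u = (\<Sum>y\<in>exceptional_units R. theta k R (u \<otimes> inv y))"
proof -
  let ?E = "exceptional_units R"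
  let ?T = "\<lambda>y. {x \<in> {1..k} \<rightarrow>\<^sub>E ?E. (\<Otimes>j\<in>{1..k}. x j) = u \<otimes> inv y}"
  \<comment> \<open>Appending \<open>y\<close> to \<open>x\<close> as entry \<open>Suc k\<close>
    turns the pairs in \<open>Sigma ?E ?T\<close> into the tuples counted by
    \<open>theta (Suc k) R u\<close>.\<close>
  let ?f = "\<lambda>(y, x). x(Suc k := y)"
  have ins: "{1..Suc k} = insert (Suc k) {1..k}" by auto
  have finE: "finite ?E" using fin by (rule finite_exceptional_units)
  have finprod_upd: "(\<Otimes>j\<in>{1..Suc k}. (x(Suc k := y)) j) = y \<otimes> (\<Otimes>j\<in>{1..k}. x j)"
    if "y \<in> ?E" "x \<in> {1..k} \<rightarrow>\<^sub>E ?E" for x y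
  proof -
    have x: "x \<in> {1..k} \<rightarrow> carrier R"
      using that by (auto simp: PiE_iff exceptional_units_closed)
    have "(\<Otimes>j\<in>{1..k}. (x(Suc k := y)) j) = (\<Otimes>j\<in>{1..k}. x j)"
      using x by (intro finprod_cong') auto
    moreover have "x(Suc k := y) \<in> {1..k} \<rightarrow> carrier R"
      using x by auto
    ultimately show ?thesis
      unfolding ins using that
      by (subst finprod_insert) (simp_all add: exceptional_units_closed fun_upd_same del: fun_upd_apply)
  qed
  have prod_iff: "(\<Otimes>j\<in>{1..Suc k}. (x(Suc k := y)) j) = u
      \<longleftrightarrow> (\<Otimes>j\<in>{1..k}. x j) = u \<otimes> inv y"
    if "y \<in> ?E" "x \<in> {1..k} \<rightarrow>\<^sub>E ?E" for x y
  proof -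
    have "(\<Otimes>j\<in>{1..k}. x j) \<in> carrier R"
      using that by (intro finprod_closed) (auto simp: PiE_iff exceptional_units_closed)
    then show ?thesis
      unfolding finprod_upd[OF that]
      using mult_eq_iff_eq_mult_inv that u by (simp add: exceptional_units_Units Units_closed)
  qed
  have image: "{x \<in> {1..Suc k} \<rightarrow>\<^sub>E ?E. (\<Otimes>j\<in>{1..Suc k}. x j) = u} = ?f ` Sigma ?E ?T"
  proof (intro equalityI subsetI)
    fix z assume z: "z \<in> {x \<in> {1..Suc k} \<rightarrow>\<^sub>E ?E. (\<Otimes>j\<in>{1..Suc k}. x j) = u}"
    then obtain y x where yx: "z = x(Suc k := y)" "y \<in> ?E" "x \<in> {1..k} \<rightarrow>\<^sub>E ?E"
      unfolding ins PiE_insert_eq by auto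
    then have "(\<Otimes>j\<in>{1..k}. x j) = u \<otimes> inv y"
      using z prod_iff[of y x] by (simp del: fun_upd_apply)
    with yx show "z \<in> ?f ` Sigma ?E ?T"
      by (intro image_eqI[of _ _ "(y, x)"]) auto
  next
    fix z assume "z \<in> ?f ` Sigma ?E ?T"
    then obtain y x where z: "z = x(Suc k := y)" and yx: "y \<in> ?E" "x \<in> {1..k} \<rightarrow>\<^sub>E ?E"
      and prod: "(\<Otimes>j\<in>{1..k}. x j) = u \<otimes> inv y"
      by auto
    have "z \<in> {1..Suc k} \<rightarrow>\<^sub>E ?E"
      unfolding ins PiE_insert_eq using z yx by auto
    with prod_iff[OF yx] prod z show "z \<in> {x \<in> {1..Suc k} \<rightarrow>\<^sub>E ?E. (\<Otimes>j\<in>{1..Suc k}. x j) = u}"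
      by (simp del: fun_upd_apply)
  qed
  \<comment> \<open>Overwriting position \<open>Suc k\<close> loses nothing: \<open>x\<close> is
    extensional on \<open>{1..k}\<close>, so its value there is always
    \<open>undefined\<close>.\<close>
  have "inj_on ?f (?E \<times> ({1..k} \<rightarrow>\<^sub>E ?E))"
    by (rule inj_combinator) auto
  then have "inj_on ?f (Sigma ?E ?T)"
    by (rule inj_on_subset) auto
  then have "theta (Suc k) R u = card (Sigma ?E ?T)"
    unfolding theta_def image by (rule card_image)
  also have "\<dots> = (\<Sum>y\<in>?E. card (?T y))"
    using finE by (intro card_SigmaI) (simp_all add: finite_PiE)
  finally show ?thesis by (simp add: theta_def)
qed

end

section \<open>Finite products\<close>

text \<open>The product decomposition is encoded by its projections: homomorphisms whose joint
  coordinate map is bijective. The counting is thereby independent of how the product is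
  represented, and the factors are arbitrary commutative rings at this stage.\<close>

locale finite_ring_product = cring R for R :: "('a, 'm) ring_scheme" (structure) +
  fixes I :: "'i set" and S :: "'i \<Rightarrow> ('b, 'n) ring_scheme" and p :: "'i \<Rightarrow> 'a \<Rightarrow> 'b"
  assumes finite_carrier: "finite (carrier R)"
    and finite_index: "finite I"
    and cring_factor: "i \<in> I \<Longrightarrow> cring (S i)"
    and proj_hom: "i \<in> I \<Longrightarrow> p i \<in> ring_hom R (S i)"
    and bij_proj: "bij_betw (\<lambda>x. \<lambda>i\<in>I. p i x) (carrier R) (\<Pi>\<^sub>E i\<in>I. carrier (S i))"
begin

lemma proj_closed: "i \<in> I \<Longrightarrow> x \<in> carrier R \<Longrightarrow> p i x \<in> carrier (S i)"
  using proj_hom ring_hom_closed by metis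

text \<open>Injectivity of the coordinate map; \<open>proj_lift\<close> is the surjective half of
  \<open>bij_proj\<close>.\<close>

lemma proj_eqI:
  assumes "x \<in> carrier R" "y \<in> carrier R" "\<And>i. i \<in> I \<Longrightarrow> p i x = p i y"
  shows "x = y"
proof -
  have "(\<lambda>i\<in>I. p i x) = (\<lambda>i\<in>I. p i y)" using assms(3) by auto
  then show ?thesis
    using assms(1,2) bij_proj unfolding bij_betw_def by (metis (no_types, lifting) inj_onD)
qed

lemma proj_lift:
  assumes "\<And>i. i \<in> I \<Longrightarrow> z i \<in> carrier (S i)"
  obtains x where "x \<in> carrier R" "\<And>i. i \<in> I \<Longrightarrow> p i x = z i"
proof -
  have "(\<lambda>i\<in>I. z i) \<in> (\<Pi>\<^sub>E i\<in>I. carrier (S i))" using assms by auto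
  then obtain x where x: "x \<in> carrier R" "(\<lambda>i\<in>I. p i x) = (\<lambda>i\<in>I. z i)"
    using bij_proj unfolding bij_betw_def by (metis (no_types, lifting) imageE)
  have "p i x = z i" if "i \<in> I" for i
    using fun_cong[OF x(2), of i] that by simp
  with x(1) show thesis by (rule that)
qed

lemma finite_factor:
  assumes i: "i \<in> I"
  shows "finite (carrier (S i))"
proof (rule finite_subset)
  show "carrier (S i) \<subseteq> p i ` carrier R"
  proof
    fix a assume a: "a \<in> carrier (S i)"
    \<comment> \<open>Only coordinate \<open>i\<close> of the preimage is prescribed;
      \<open>\<one>\<close> serves as a filler in the others.\<close>
    have "(if j = i then a else \<one>\<^bsub>S j\<^esub>) \<in> carrier (S j)" if "j \<in> I" for j
      using a cring.cring_simprules(6)[OF cring_factor[OF that]] by simp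
    then obtain x where "x \<in> carrier R" "\<And>j. j \<in> I \<Longrightarrow> p j x = (if j = i then a else \<one>\<^bsub>S j\<^esub>)"
      using proj_lift[of "\<lambda>j. if j = i then a else \<one>\<^bsub>S j\<^esub>"] by blast
    with i show "a \<in> p i ` carrier R" by force
  qed
qed (simp add: finite_carrier)

lemma proj_one: "i \<in> I \<Longrightarrow> p i \<one> = \<one>\<^bsub>S i\<^esub>"
  using proj_hom ring_hom_one by blast

lemma proj_mult:
  "i \<in> I \<Longrightarrow> x \<in> carrier R \<Longrightarrow> y \<in> carrier R \<Longrightarrow> p i (x \<otimes> y) = p i x \<otimes>\<^bsub>S i\<^esub> p i y"
  using proj_hom ring_hom_mult by metis

lemma proj_minus:
  assumes "i \<in> I" "x \<in> carrier R" "y \<in> carrier R"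
  shows "p i (x \<ominus> y) = p i x \<ominus>\<^bsub>S i\<^esub> p i y"
proof -
  interpret Si: cring "S i" using assms(1) by (rule cring_factor)
  interpret h: ring_hom_ring R "S i" "p i"
    using proj_hom[OF assms(1)] by unfold_locales
  show ?thesis using assms by (simp add: a_minus_def)
qed

lemma proj_Units:
  assumes "i \<in> I" "x \<in> Units R"
  shows "p i x \<in> Units (S i)"
proof -
  interpret Si: cring "S i" using assms(1) by (rule cring_factor)
  have "p i (inv x) \<otimes>\<^bsub>S i\<^esub> p i x = \<one>\<^bsub>S i\<^esub>"
       "p i x \<otimes>\<^bsub>S i\<^esub> p i (inv x) = \<one>\<^bsub>S i\<^esub>"
    using assms by (simp_all flip: proj_mult add: Units_closed proj_one)
  then show ?thesis
    using assms unfolding Units_def[of "S i"]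
    by (auto intro!: bexI[of _ "p i (inv x)"] proj_closed simp: Units_closed)
qed

lemma proj_inv:
  assumes "i \<in> I" "x \<in> Units R"
  shows "p i (inv x) = inv\<^bsub>S i\<^esub> p i x"
proof -
  interpret Si: cring "S i" using assms(1) by (rule cring_factor)
  have "p i x \<otimes>\<^bsub>S i\<^esub> p i (inv x) = \<one>\<^bsub>S i\<^esub>"
    using assms by (simp flip: proj_mult add: Units_closed proj_one)
  then show ?thesis
    using assms Si.comm_inv_char by (metis Units_closed Units_inv_closed proj_closed)
qed

lemma Units_iff:
  assumes x: "x \<in> carrier R"
  shows "x \<in> Units R \<longleftrightarrow> (\<forall>i\<in>I. p i x \<in> Units (S i))"
proof
  assume *: "\<forall>i\<in>I. p i x \<in> Units (S i)"
  \<comment> \<open>The inverses of the coordinates form a family that \<open>proj_lift\<close>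
    glues to an inverse of \<open>x\<close>.\<close>
  have "inv\<^bsub>S i\<^esub> p i x \<in> carrier (S i)" if "i \<in> I" for i
  proof -
    interpret Si: cring "S i" using that by (rule cring_factor)
    show ?thesis using * that by blast
  qed
  then obtain y where y: "y \<in> carrier R" "\<And>i. i \<in> I \<Longrightarrow> p i y = inv\<^bsub>S i\<^esub> p i x"
    using proj_lift[of "\<lambda>i. inv\<^bsub>S i\<^esub> p i x"] by blast
  have "x \<otimes> y = \<one>"
  proof (rule proj_eqI)
    fix i assume i: "i \<in> I"
    interpret Si: cring "S i" using i by (rule cring_factor)
    show "p i (x \<otimes> y) = p i \<one>" using x y i * by (simp add: proj_mult proj_one)
  qed (use x y in auto)
  then show "x \<in> Units R"
    using x y m_comm unfolding Units_def by (auto intro!: bexI[of _ y])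
qed (simp add: proj_Units)

lemma exceptional_units_iff:
  assumes x: "x \<in> carrier R"
  shows "x \<in> exceptional_units R \<longleftrightarrow> (\<forall>i\<in>I. p i x \<in> exceptional_units (S i))"
  using x by (auto simp: exceptional_units_def Units_iff proj_minus proj_one)

lemma bij_exceptional_units:
  "bij_betw (\<lambda>x. \<lambda>i\<in>I. p i x) (exceptional_units R) (\<Pi>\<^sub>E i\<in>I. exceptional_units (S i))"
proof -
  have "(\<lambda>x. \<lambda>i\<in>I. p i x) ` exceptional_units R = (\<Pi>\<^sub>E i\<in>I. exceptional_units (S i))"
  proof (intro equalityI subsetI)
    fix z assume z: "z \<in> (\<Pi>\<^sub>E i\<in>I. exceptional_units (S i))"
    have "z i \<in> carrier (S i)" if "i \<in> I" for i
      using z that cring.exceptional_units_closed[OF cring_factor] by blast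
    then obtain x where x: "x \<in> carrier R" "\<And>i. i \<in> I \<Longrightarrow> p i x = z i"
      using proj_lift[of z] by blast
    have "z = restrict z I"
      using z by (simp add: PiE_restrict)
    also have "\<dots> = (\<lambda>i\<in>I. p i x)"
      by (rule restrict_ext) (simp add: x(2))
    finally have "z = (\<lambda>i\<in>I. p i x)" .
    moreover have "x \<in> exceptional_units R"
      using z x by (auto simp: exceptional_units_iff)
    ultimately show "z \<in> (\<lambda>x. \<lambda>i\<in>I. p i x) ` exceptional_units R" by blast
  next
    fix z assume "z \<in> (\<lambda>x. \<lambda>i\<in>I. p i x) ` exceptional_units R"
    then obtain x where x: "x \<in> exceptional_units R" "z = (\<lambda>i\<in>I. p i x)" by blast
    then have "\<forall>i\<in>I. p i x \<in> exceptional_units (S i)"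
      using exceptional_units_iff exceptional_units_closed by blast
    then show "z \<in> (\<Pi>\<^sub>E i\<in>I. exceptional_units (S i))"
      using x(2) by (simp add: restrict_PiE_iff)
  qed
  moreover have "inj_on (\<lambda>x. \<lambda>i\<in>I. p i x) (exceptional_units R)"
    using bij_proj exceptional_units_closed unfolding bij_betw_def
    by (meson inj_on_subset subsetI)
  ultimately show ?thesis by (simp add: bij_betw_def)
qed

theorem theta_eq_prod:
  "u \<in> Units R \<Longrightarrow> theta k R u = (\<Prod>i\<in>I. theta k (S i) (p i u))"
proof (induction k arbitrary: u)
  case 0
  \<comment> \<open>For length 0 both sides are indicators, and a product of indicators is 1 exactly
    if every coordinate of \<open>u\<close> is the identity.\<close>
  have "u = \<one> \<longleftrightarrow> (\<forall>i\<in>I. p i u = \<one>\<^bsub>S i\<^esub>)"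
    using proj_eqI[of u \<one>] 0 by (auto simp: proj_one Units_closed)
  moreover have "theta 0 (S i) (p i u) = (if p i u = \<one>\<^bsub>S i\<^esub> then 1 else 0)" if "i \<in> I" for i
    using cring.theta_0[OF cring_factor[OF that]] .
  ultimately show ?case
    using finite_index by (auto simp: theta_0)
next
  case (Suc k)
  let ?E = "exceptional_units R" and ?Ei = "\<lambda>i. exceptional_units (S i)"
  let ?t = "\<lambda>i y. theta k (S i) (p i u \<otimes>\<^bsub>S i\<^esub> inv\<^bsub>S i\<^esub> y)"
  have "theta (Suc k) R u = (\<Sum>y\<in>?E. theta k R (u \<otimes> inv y))"
    using finite_carrier Suc.prems by (rule theta_Suc)
  \<comment> \<open>Writing the coordinates of \<open>y\<close> through the restricted family makes
    the summand a function of that family, so that \<open>bij_exceptional_units\<close> can reindex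
    the sum.\<close>
  also have "\<dots> = (\<Sum>y\<in>?E. \<Prod>i\<in>I. ?t i ((\<lambda>i\<in>I. p i y) i))"
  proof (rule sum.cong[OF refl])
    fix y assume y: "y \<in> ?E"
    then have yU: "y \<in> Units R" by (rule exceptional_units_Units)
    have "theta k R (u \<otimes> inv y) = (\<Prod>i\<in>I. theta k (S i) (p i (u \<otimes> inv y)))"
      using Suc yU by simp
    also have "\<dots> = (\<Prod>i\<in>I. ?t i ((\<lambda>i\<in>I. p i y) i))"
      using yU Suc.prems by (intro prod.cong) (simp_all add: proj_mult proj_inv Units_closed)
    finally show "theta k R (u \<otimes> inv y) = (\<Prod>i\<in>I. ?t i ((\<lambda>i\<in>I. p i y) i))" .
  qed
  also have "\<dots> = (\<Sum>z\<in>PiE I ?Ei. \<Prod>i\<in>I. ?t i (z i))"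
    by (rule sum.reindex_bij_betw[OF bij_exceptional_units])
  \<comment> \<open>Distributivity: the \<open>i\<close>-th term depends on \<open>z i\<close> only.
    Each resulting sum is the recurrence \<open>theta_Suc\<close> for one factor.\<close>
  also have "\<dots> = (\<Prod>i\<in>I. \<Sum>y\<in>?Ei i. ?t i y)"
    by (rule prod_sum_PiE[symmetric])
       (auto simp: finite_index finite_factor intro!: cring.finite_exceptional_units cring_factor)
  also have "\<dots> = (\<Prod>i\<in>I. theta (Suc k) (S i) (p i u))"
    by (intro prod.cong refl)
       (simp add: cring.theta_Suc[OF cring_factor] finite_factor proj_Units Suc.prems)
  finally show ?case .
qed

end

section \<open>The direct product of a list of rings as a finite ring product\<close>

lemma RDirProd_list_proj_hom:
  "i < length Rs \<Longrightarrow> (\<lambda>xs. xs ! i) \<in> ring_hom (RDirProd_list Rs) (Rs ! i)"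
proof (induction Rs arbitrary: i)
  case (Cons A Rs)
  let ?P = "RDirProd_list (A # Rs)" and ?Q = "RDirProd_list Rs"
  note hom = RDirProd_list_hom1[of A Rs]
  \<comment> \<open>\<open>RDirProd_list_hom1\<close> makes the map from \<open>(a, as)\<close> to
    \<open>a # as\<close> a homomorphism on the binary product, so the operations split into head
    and tail.\<close>
  have ops: "(a # as) \<otimes>\<^bsub>?P\<^esub> (b # bs) = (a \<otimes>\<^bsub>A\<^esub> b) # (as \<otimes>\<^bsub>?Q\<^esub> bs)"
      "(a # as) \<oplus>\<^bsub>?P\<^esub> (b # bs) = (a \<oplus>\<^bsub>A\<^esub> b) # (as \<oplus>\<^bsub>?Q\<^esub> bs)"
    if "a \<in> carrier A" "b \<in> carrier A" "as \<in> carrier ?Q" "bs \<in> carrier ?Q" for a b as bs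
    using ring_hom_mult[OF hom, of "(a, as)" "(b, bs)"] ring_hom_add[OF hom, of "(a, as)" "(b, bs)"] that
    by (auto simp: RDirProd_def DirProd_def monoid.defs)
  have one: "\<one>\<^bsub>?P\<^esub> = \<one>\<^bsub>A\<^esub> # \<one>\<^bsub>?Q\<^esub>"
    by (simp add: RDirProd_list_one)
  have carr: "xs \<in> carrier ?P \<Longrightarrow> \<exists>a as. xs = a # as \<and> a \<in> carrier A \<and> as \<in> carrier ?Q" for xs
    by (auto simp: RDirProd_list_carrier)
  show ?case
  proof (cases i)
    case 0
    then show ?thesis
      by (intro ring_hom_memI) (auto dest!: carr simp: ops one)
  next
    case (Suc j)
    then have "(\<lambda>xs. xs ! j) \<in> ring_hom ?Q (Rs ! j)"
      using Cons by simp
    note hom = ring_hom_memE[OF this]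
    from Suc show ?thesis
      by (intro ring_hom_memI) (auto dest!: carr simp: ops one hom)
  qed
qed simp

text \<open>The inverse map tabulates a family along \<open>[0..<length Rs]\<close>.\<close>

lemma bij_betw_RDirProd_list_proj:
  "bij_betw (\<lambda>xs. \<lambda>i\<in>{..<length Rs}. xs ! i) (carrier (RDirProd_list Rs))
     (\<Pi>\<^sub>E i\<in>{..<length Rs}. carrier (Rs ! i))"
proof (rule bij_betwI[where g = "\<lambda>z. map z [0..<length Rs]"])
  show "(\<lambda>z. map z [0..<length Rs])
      \<in> (\<Pi>\<^sub>E i\<in>{..<length Rs}. carrier (Rs ! i)) \<rightarrow> carrier (RDirProd_list Rs)"
  proof (intro funcsetI RDirProd_list_carrier_memI)
    fix z i assume "z \<in> (\<Pi>\<^sub>E i\<in>{..<length Rs}. carrier (Rs ! i))" "i < length Rs"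
    then show "map z [0..<length Rs] ! i \<in> carrier (Rs ! i)"
      using PiE_mem[of z "{..<length Rs}" "\<lambda>i. carrier (Rs ! i)" i] by simp
  qed simp
next
  fix xs assume "xs \<in> carrier (RDirProd_list Rs)"
  then show "map (\<lambda>i\<in>{..<length Rs}. xs ! i) [0..<length Rs] = xs"
    by (intro nth_equalityI) (simp_all add: RDirProd_list_carrier_mem(1))
next
  fix z assume z: "z \<in> (\<Pi>\<^sub>E i\<in>{..<length Rs}. carrier (Rs ! i))"
  have "(\<lambda>i\<in>{..<length Rs}. map z [0..<length Rs] ! i) = restrict z {..<length Rs}"
    by (rule restrict_ext) simp
  also have "\<dots> = z" using z by (rule PiE_restrict)
  finally show "(\<lambda>i\<in>{..<length Rs}. map z [0..<length Rs] ! i) = z" .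
qed (simp add: RDirProd_list_carrier_mem(2))

lemma finite_ring_product_RDirProd_list:
  assumes "cring R" "finite (carrier R)"
    and "\<And>i. i < length Rs \<Longrightarrow> cring (Rs ! i)"
    and iso: "\<phi> \<in> ring_iso R (RDirProd_list Rs)"
  shows "finite_ring_product R {..<length Rs} (\<lambda>i. Rs ! i) (\<lambda>i x. \<phi> x ! i)"
proof -
  have hom: "\<phi> \<in> ring_hom R (RDirProd_list Rs)"
    and bij: "bij_betw \<phi> (carrier R) (carrier (RDirProd_list Rs))"
    using iso by (auto simp: ring_iso_def)
  have "(\<lambda>x. \<phi> x ! i) \<in> ring_hom R (Rs ! i)" if "i < length Rs" for i
    using ring_hom_trans[OF hom RDirProd_list_proj_hom[OF that]] by (simp add: comp_def)
  moreover have "bij_betw (\<lambda>x. \<lambda>i\<in>{..<length Rs}. \<phi> x ! i) (carrier R)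
      (\<Pi>\<^sub>E i\<in>{..<length Rs}. carrier (Rs ! i))"
    using bij_betw_trans[OF bij bij_betw_RDirProd_list_proj] by (simp add: comp_def)
  ultimately show ?thesis
    using assms by (simp add: finite_ring_product_def finite_ring_product_axioms_def)
qed

section \<open>Finite local rings\<close>

context cring
begin

text \<open>The proper ideals containing \<open>a\<close> form a finite set, which is nonempty
  because \<open>PIdl a\<close> is proper for a nonunit. An inclusion-maximal member is then a
  maximal ideal.\<close>

lemma nonunit_in_maximalideal:
  assumes fin: "finite (carrier R)" and a: "a \<in> carrier R" "a \<notin> Units R"
  shows "\<exists>M. maximalideal M R \<and> a \<in> M"
proof -
  let ?J = "{J. ideal J R \<and> a \<in> J \<and> J \<noteq> carrier R}"
  have sub: "J \<subseteq> carrier R" if "ideal J R" for J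
    using that by (simp add: ideal.axioms(1) additive_subgroup.a_subset)
  have "?J \<subseteq> Pow (carrier R)"
    using sub by blast
  then have "finite ?J"
    using fin by (simp add: finite_subset)
  moreover have "PIdl a \<in> ?J"
  proof -
    have "\<one> \<notin> PIdl a"
    proof
      assume "\<one> \<in> PIdl a"
      then obtain x where "x \<in> carrier R" "\<one> = x \<otimes> a"
        unfolding cgenideal_def by blast
      then have "a \<in> Units R"
        using a m_comm[of x a] unfolding Units_def by auto
      with a show False by simp
    qed
    then have "PIdl a \<noteq> carrier R" by auto
    then show ?thesis
      using a cgenideal_ideal[of a] cgenideal_self[of a] by simp
  qed
  ultimately obtain M where M: "M \<in> ?J" and max: "\<forall>J\<in>?J. M \<subseteq> J \<longrightarrow> M = J"
    using finite_has_maximal[of ?J] by blast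
  have "maximalideal M R"
  proof (rule maximalidealI)
    fix J assume J: "ideal J R" "M \<subseteq> J"
    with M have "a \<in> J" by blast
    with J max show "J = M \<or> J = carrier R" by blast
  qed (use M in auto)
  with M show ?thesis by blast
qed

end

locale finite_local_ring = local_ring +
  assumes finite_carrier: "finite (carrier R)"
begin

abbreviation M where "M \<equiv> max_ideal R"
abbreviation m where "m \<equiv> card M"
abbreviation q where "q \<equiv> residue_card R"

sublocale M: maximalideal M R
  using maximalideal_iff_max_ideal by blast

sublocale M: abelian_subgroup M R
  by (rule abelian_subgroupI3[OF M.is_additive_subgroup abelian_group_axioms])

text \<open>A unit in \<open>M\<close> would force \<open>\<one>\<close> into \<open>M\<close>.
  Conversely, a nonunit lies in some maximal ideal, and by locality this is
  \<open>M\<close>.\<close>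

lemma Units_eq: "Units R = carrier R - M"
proof -
  have "x \<notin> M" if "x \<in> Units R" for x
  proof
    assume "x \<in> M"
    then have "inv x \<otimes> x \<in> M"
      using that M.I_l_closed by blast
    then have "M = carrier R"
      using that M.one_imp_carrier by simp
    then show False using M.I_notcarr by simp
  qed
  then show ?thesis
    using nonunit_in_maximalideal[OF finite_carrier] maximalideal_iff_max_ideal by auto
qed

section \<open>Cosets of the maximal ideal and the number of exceptional units\<close>

lemma mem_coset_iff:
  assumes "x \<in> carrier R" "y \<in> carrier R"
  shows "x \<in> M +> y \<longleftrightarrow> x \<ominus> y \<in> M"
  using M.a_rcos_module_minus[OF ring_axioms] assms by blast

lemma coset_sym:
  assumes "x \<in> carrier R" "y \<in> carrier R"
  shows "x \<in> M +> y \<longleftrightarrow> y \<in> M +> x"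
  using assms M.a_repr_independence' M.a_rcos_self by metis

text \<open>Bridges the left coset in \<open>sigma\<close> and the right cosets used in the proofs
  below.\<close>

lemma l_coset_eq: "\<one> <+ M = M +> \<one>"
  using M.a_coset_eq by simp

lemma exceptional_units_eq: "exceptional_units R = carrier R - M - (M +> \<one>)"
proof -
  have "\<one> \<ominus> x \<in> M \<longleftrightarrow> x \<in> M +> \<one>" if "x \<in> carrier R" for x
    using that coset_sym mem_coset_iff by simp
  then show ?thesis
    unfolding exceptional_units_def Units_eq by auto
qed

lemma card_coset: "x \<in> carrier R \<Longrightarrow> card (M +> x) = m"
  using a_card_cosets_equal[of "M +> x" M] finite_carrier M.a_subset a_rcosetsI by blast

lemma coset_closed: "x \<in> carrier R \<Longrightarrow> M +> x \<subseteq> carrier R"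
  by (simp add: M.a_subset a_r_coset_subset_G)

lemma coset_disjoint:
  assumes "x \<in> carrier R" "y \<in> carrier R" "x \<notin> M +> y"
  shows "(M +> x) \<inter> (M +> y) = {}"
  using assms M.a_repr_independence' M.a_rcos_self by (metis disjoint_iff)

text \<open>\<open>M\<close> is itself the coset of \<open>\<zero>\<close>, and a unit lies outside
  it.\<close>

lemma M_disjoint_coset: "x \<in> Units R \<Longrightarrow> (M +> x) \<inter> M = {}"
  using coset_disjoint[of x \<zero>] M.a_rcos_const[of \<zero>] by (auto simp: Units_eq)

text \<open>Lagrange for the additive group: \<open>q\<close> counts the cosets of
  \<open>M\<close>.\<close>

lemma card_carrier: "card (carrier R) = q * m"
proof -
  have "card (a_rcosets M) * m = card (carrier R)"
    using a_lagrange[OF finite_carrier M.is_additive_subgroup] by (simp add: order_def)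
  then show ?thesis by (simp add: residue_card_def FactRing_def)
qed

text \<open>Two disjoint cosets of size \<open>m\<close> are removed from \<open>q\<close> of them.
  Real numbers avoid truncated subtraction and match \<open>sigma\<close>.\<close>

lemma card_exceptional_units: "real (card (exceptional_units R)) = real m * (real q - 2)"
proof -
  let ?E = "exceptional_units R"
  have fin: "finite ?E" "finite M" "finite (M +> \<one>)"
    using finite_carrier finite_subset[OF M.a_subset] finite_subset[OF coset_closed[OF one_closed]]
    by (simp_all add: finite_exceptional_units)
  have "carrier R = ?E \<union> (M \<union> (M +> \<one>))"
    using M.a_subset coset_closed[OF one_closed] by (auto simp: exceptional_units_eq)
  moreover have "?E \<inter> (M \<union> (M +> \<one>)) = {}"
    by (auto simp: exceptional_units_eq)
  moreover have "card (M \<union> (M +> \<one>)) = 2 * m"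
    using fin M_disjoint_coset[of \<one>] card_coset[of \<one>] by (subst card_Un_disjoint) auto
  ultimately have "card (carrier R) = card ?E + 2 * m"
    using fin by (metis card_Un_disjoint finite_UnI)
  then have "real q * real m = real (card ?E) + 2 * real m"
    unfolding card_carrier by (metis of_nat_add of_nat_mult of_nat_numeral)
  then show ?thesis by (simp add: algebra_simps)
qed

text \<open>Multiplying \<open>u / y - 1\<close> by the unit \<open>y\<close> gives
  \<open>u - y\<close>, and multiplication by a unit preserves membership in \<open>M\<close> in
  both directions.\<close>

lemma div_in_coset_one_iff:
  assumes u: "u \<in> Units R" and y: "y \<in> Units R"
  shows "u \<otimes> inv y \<in> M +> \<one> \<longleftrightarrow> y \<in> M +> u"
proof -
  let ?d = "u \<otimes> inv y \<ominus> \<one>"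
  have d: "?d \<in> carrier R" using u y by (simp add: Units_closed)
  have "u \<otimes> inv y \<otimes> y = u"
    using u y by (simp add: m_assoc Units_closed)
  then have eq: "?d \<otimes> y = u \<ominus> y"
    using u y by (simp add: a_minus_def l_distr l_minus Units_closed)
  have "?d \<in> M \<longleftrightarrow> ?d \<otimes> y \<in> M"
  proof
    assume "?d \<otimes> y \<in> M"
    then have "?d \<otimes> y \<otimes> inv y \<in> M" using y M.I_r_closed by blast
    then show "?d \<in> M" using d y by (simp add: m_assoc Units_closed)
  qed (use y M.I_r_closed in \<open>blast intro: Units_closed\<close>)
  then show ?thesis
    unfolding eq using u y coset_sym[of y u] by (simp add: mem_coset_iff Units_closed)
qed

lemma coset_subset_exceptional_units:
  assumes "u \<in> Units R" "u \<notin> M +> \<one>"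
  shows "M +> u \<subseteq> exceptional_units R"
  using assms M_disjoint_coset[of u] coset_disjoint[of u \<one>] coset_closed[of u]
  by (auto simp: exceptional_units_eq Units_closed)

text \<open>The closed form is checked against the two-value recurrence by induction. Using length
  \<open>Suc k\<close> makes the exponent of \<open>m\<close> simply \<open>k\<close>, and
  \<open>q > 1\<close> makes \<open>real q - 1\<close> invertible.\<close>

lemma theta_local:
  assumes q: "q > 1"
  shows "u \<in> Units R \<Longrightarrow> real (theta (Suc k) R u) = real m ^ k * inverse (real q - 1) * sigma (Suc k) R u"
proof (induction k arbitrary: u)
  let ?E = "exceptional_units R"
  have finE: "finite ?E" using finite_carrier by (rule finite_exceptional_units)
  case 0
  \<comment> \<open>For length 1 the count is 1 if \<open>u\<close> is exceptional and 0 otherwise.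
    The formula agrees, since \<open>sigma\<close> is then \<open>q - 1\<close> off
    \<open>1 + M\<close> and 0 on it.\<close>
  have "theta (Suc 0) R u = (\<Sum>y\<in>?E. if u = y then 1 else 0)"
    unfolding theta_Suc[OF finite_carrier 0] theta_0
  proof (intro sum.cong refl if_cong)
    fix y assume "y \<in> ?E"
    then show "u \<otimes> inv y = \<one> \<longleftrightarrow> u = y"
      using 0 mult_eq_iff_eq_mult_inv[of y \<one> u]
      by (auto simp: exceptional_units_Units Units_closed)
  qed
  then have "theta (Suc 0) R u = (if u \<in> M +> \<one> then 0 else 1)"
    using finE 0 by (auto simp: exceptional_units_eq Units_eq)
  then show ?case
    using q by (simp add: sigma_def l_coset_eq Let_def)
next
  let ?E = "exceptional_units R"
  have finE: "finite ?E" using finite_carrier by (rule finite_exceptional_units)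
  case (Suc k)
  \<comment> \<open>By the induction hypothesis, \<open>A\<close> and \<open>B\<close> are the
    values of \<open>theta (Suc k) R\<close> at units inside and outside
    \<open>1 + M\<close>.\<close>
  define A where "A = real m ^ k * inverse (real q - 1) * ((real q - 2) ^ Suc k + (-1) ^ Suc k * (real q - 2))"
  define B where "B = real m ^ k * inverse (real q - 1) * ((real q - 2) ^ Suc k + (-1) ^ Suc (Suc k))"
  have step: "real (theta k' R (u \<otimes> inv y)) = (if y \<in> M +> u then A else B)"
    if "y \<in> ?E" "k' = Suc k" for y k'
  proof -
    have yU: "y \<in> Units R" using that(1) by (rule exceptional_units_Units)
    show ?thesis
      unfolding that(2) using Suc yU
      by (simp add: sigma_def Let_def l_coset_eq div_in_coset_one_iff A_def B_def)
  qed
  have sum: "real (theta (Suc (Suc k)) R u) = (\<Sum>y\<in>?E. if y \<in> M +> u then A else B)"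
    using theta_Suc[OF finite_carrier Suc.prems, of "Suc k"] step by simp
  show ?case
  proof (cases "u \<in> M +> \<one>")
    case True
    then have "M +> u = M +> \<one>"
      using M.a_repr_independence' by blast
    \<comment> \<open>No exceptional unit lies in \<open>u + M = 1 + M\<close>, so every summand is
      \<open>B\<close>.\<close>
    then have "real (theta (Suc (Suc k)) R u) = (\<Sum>y\<in>?E. B)"
      unfolding sum by (intro sum.cong) (auto simp: exceptional_units_eq)
    also have "\<dots> = real m * (real q - 2) * B"
      by (simp add: card_exceptional_units)
    finally show ?thesis
      using True by (simp add: sigma_def Let_def l_coset_eq B_def algebra_simps)
  next
    case False
    let ?C = "M +> u"
    \<comment> \<open>All \<open>m\<close> elements of \<open>u + M\<close> are exceptional; they
      contribute \<open>A\<close> each, and the remaining \<open>m (q - 3)\<close> contribute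
      \<open>B\<close>.\<close>
    have sub: "?C \<subseteq> ?E"
      using Suc.prems False by (rule coset_subset_exceptional_units)
    have cC: "card ?C = m" using Suc.prems by (simp add: card_coset Units_closed)
    have "real (theta (Suc (Suc k)) R u) = (\<Sum>y\<in>?E - ?C. B) + (\<Sum>y\<in>?C. A)"
      unfolding sum sum.subset_diff[OF sub finE] by simp
    also have "\<dots> = (real m * (real q - 2) - real m) * B + real m * A"
      using sub finE cC card_exceptional_units card_mono[OF finE sub]
      by (simp add: card_Diff_subset finite_subset of_nat_diff)
    also have "\<dots> = real m * (A + (real q - 3) * B)"
      by (simp add: algebra_simps)
    \<comment> \<open>The powers combine by \<open>1 + (q - 3) = q - 2\<close>; the signed terms
      leave \<open>(q - 2) - (q - 3) = 1\<close> times \<open>(-1) ^ Suc k\<close>.\<close>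
    also have "A + (real q - 3) * B
        = real m ^ k * inverse (real q - 1) * ((real q - 2) ^ Suc (Suc k) + (-1) ^ Suc k)"
      unfolding A_def B_def by (simp add: algebra_simps)
    finally show ?thesis
      using False by (simp add: sigma_def Let_def l_coset_eq)
  qed
qed

end

theorem theorem1p8:
  fixes R :: "('a, 'm) ring_scheme"
    and Rs :: "('b, 'n) ring_scheme list"
    and \<phi> :: "'a \<Rightarrow> 'b list"
    and k :: nat
    and u :: 'a
  assumes "cring R"
    and "finite (carrier R)"
    and "\<And>i. i < length Rs \<Longrightarrow> local_ring (Rs ! i)"
    and "\<phi> \<in> ring_iso R (RDirProd_list Rs)"
    and "\<And>i. i < length Rs \<Longrightarrow> residue_card (Rs ! i) > 2"
    and "k \<ge> 2"
    and "u \<in> Units R"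
  shows "real (theta k R u) =
    (\<Prod>i<length Rs.
      real (card (max_ideal (Rs ! i))) ^ (k - 1)
        * inverse (real (residue_card (Rs ! i)) - 1)
        * sigma k (Rs ! i) (\<phi> u ! i))"
proof -
  interpret finite_ring_product R "{..<length Rs}" "\<lambda>i. Rs ! i" "\<lambda>i x. \<phi> x ! i"
    using assms(1-4) by (intro finite_ring_product_RDirProd_list) (auto dest: local_ring.axioms(1))
  \<comment> \<open>The local formula is stated for successors, so \<open>k - 1\<close> becomes
    \<open>k'\<close>.\<close>
  obtain k' where k: "k = Suc k'" using assms(6) by (cases k) auto
  have "real (theta k (Rs ! i) (\<phi> u ! i)) = real (card (max_ideal (Rs ! i))) ^ (k - 1)
      * inverse (real (residue_card (Rs ! i)) - 1) * sigma k (Rs ! i) (\<phi> u ! i)"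
    if "i < length Rs" for i
  proof -
    \<comment> \<open>Each factor inherits finiteness from \<open>R\<close> through its surjective
      projection.\<close>
    interpret L: finite_local_ring "Rs ! i"
      using assms(3)[OF that] finite_factor that
      by (simp add: finite_local_ring_def finite_local_ring_axioms_def)
    show ?thesis
      using L.theta_local[of "\<phi> u ! i" k'] assms(5)[OF that] proj_Units[of i u] that assms(7) k
      by simp
  qed
  then show ?thesis
    using theta_eq_prod[OF assms(7), of k] by simp
qed

end
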